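(* Let $\delta=(E[a(X)b(Z)'])^{-1}E[a(X)Y]$ and $\bar\gamma(Z)=b(Z)'\delta$ (the linear instrumental variables estimand with right-hand side variables $b(Z)$ and the same number of instruments $a(X)$). If $-\partial\ln f_0(Z)/\partial z_1=c'b(Z)$ for a constant vector $c$, $E[b(Z)b(Z)']$ is nonsingular, and $E[a(X)|Z]=\Pi b(Z)$ for a square nonsingular matrix $\Pi$, then $$\theta_0=E[\partial\bar\gamma(Z)/\partial z_1].$$
   Context: $W=(Y,Z,X)$, with scalar outcome $Y$, right-hand side variables $Z$ continuously distributed with pdf $f_0(z)$, and instruments $X$. $\gamma_0$ satisfies the nonparametric instrumental variables restriction $E[Y-\gamma_0(Z)|X]=0$. The parameter of interest is the average derivative $\theta_0=E[\partial\gamma_0(Z)/\partial z_1]$, with $z_1$ the first component of $z$. $a(X)$ and $b(Z)$ are vectors of functions of the same dimension; $Y$, $\gamma_0(Z)$, $a(X)$, $b(Z)$ have finite second moments; and $\gamma_0$, $b$, $f_0$ are differentiable in $z_1$ and regular enough (boundary terms vanish) that integration by parts $E[\partial\gamma(Z)/\partial z_1]=-E[\{\partial\ln f_0(Z)/\partial z_1\}\gamma(Z)]$ holds for $\gamma=\gamma_0$ and $\gamma=\bar\gamma$. *)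

theory Defs
  imports "HOL-Probability.Probability"
begin

definition partial_deriv :: "'n::finite \<Rightarrow> (real ^ 'n \<Rightarrow> real) \<Rightarrow> real ^ 'n \<Rightarrow> real" where
  "partial_deriv k g z = deriv (\<lambda>t. g (z + t *\<^sub>R axis k 1)) 0"

definition partial_differentiable :: "'n::finite \<Rightarrow> (real ^ 'n \<Rightarrow> real) \<Rightarrow> real ^ 'n \<Rightarrow> bool" where
  "partial_differentiable k g z \<longleftrightarrow> (\<lambda>t. g (z + t *\<^sub>R axis k 1)) differentiable at 0"

definition average_derivative ::
    "'w measure \<Rightarrow> ('w \<Rightarrow> real ^ 'n::finite) \<Rightarrow> 'n \<Rightarrow> (real ^ 'n \<Rightarrow> real) \<Rightarrow> real" where
  "average_derivative M Z k g = (\<integral>w. partial_deriv k g (Z w) \<partial>M)"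

(* The score of f at z in coordinate k.  It is only used at points Z w, where a density f of Z
   is almost surely positive, so the library convention for ln at 0 plays no role. *)
definition score :: "'n::finite \<Rightarrow> (real ^ 'n \<Rightarrow> real) \<Rightarrow> real ^ 'n \<Rightarrow> real" where
  "score k f = partial_deriv k (\<lambda>z. ln (f z))"

(* The two integrability clauses say that both expectations exist; without them a
   non-integrable integrand would silently contribute the value 0. *)
definition integration_by_parts ::
    "'w measure \<Rightarrow> ('w \<Rightarrow> real ^ 'n::finite) \<Rightarrow> (real ^ 'n \<Rightarrow> real) \<Rightarrow> 'n \<Rightarrow> (real ^ 'n \<Rightarrow> real) \<Rightarrow> bool"
  where
  "integration_by_parts M Z f k g \<longleftrightarrow>
     integrable M (\<lambda>w. partial_deriv k g (Z w)) \<and>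
     integrable M (\<lambda>w. score k f (Z w) * g (Z w)) \<and>
     (\<integral>w. partial_deriv k g (Z w) \<partial>M) = - (\<integral>w. score k f (Z w) * g (Z w) \<partial>M)"

definition outer_product :: "real ^ 'm \<Rightarrow> real ^ 'n \<Rightarrow> real ^ 'n ^ 'm" where
  "outer_product u v = (\<chi> i j. u $ i * v $ j)"

definition sigma_gen :: "'w measure \<Rightarrow> 'c measure \<Rightarrow> ('w \<Rightarrow> 'c) \<Rightarrow> 'w measure" where
  "sigma_gen M N V = vimage_algebra (space M) V N"

definition vec_cond_exp ::
    "'w measure \<Rightarrow> 'w measure \<Rightarrow> ('w \<Rightarrow> real ^ 'd::finite) \<Rightarrow> 'w \<Rightarrow> real ^ 'd" where
  "vec_cond_exp M F f w = (\<chi> i. real_cond_exp M F (\<lambda>v. f v $ i) w)"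

(* The value of iv_coef is the intended one only if the matrix E[a(X) b(Z)'] is nonsingular.
   This holds whenever E[a(X)|Z] = P b(Z) with P and E[b(Z) b(Z)'] nonsingular, since then
   E[a(X) b(Z)'] = P E[b(Z) b(Z)']. *)
definition iv_coef ::
    "'w measure \<Rightarrow> ('w \<Rightarrow> real) \<Rightarrow> ('w \<Rightarrow> real ^ 'n) \<Rightarrow> ('w \<Rightarrow> 'x)
      \<Rightarrow> ('x \<Rightarrow> real ^ 'd) \<Rightarrow> (real ^ 'n \<Rightarrow> real ^ 'd) \<Rightarrow> real ^ 'd::finite" where
  "iv_coef M Y Z X a b =
     matrix_inv (\<integral>w. outer_product (a (X w)) (b (Z w)) \<partial>M) *v (\<integral>w. Y w *\<^sub>R a (X w) \<partial>M)"

end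

theory Submission
  imports Defs
begin

text \<open>Integration by parts turns the average derivative of \<open>\<gamma>\<close> into the inner product
  \<open>E[(c \<bullet> b(Z)) \<gamma>(Z)]\<close> with the score, so only the moments \<open>E[\<gamma>(Z) b(Z)]\<close> matter. They agree for
  \<open>\<gamma>0\<close> and \<open>\<gamma>bar\<close>: conditioning on \<open>X\<close> and then on \<open>Z\<close> gives
  \<open>E[Y a(X)] = E[\<gamma>0(Z) a(X)] = P E[\<gamma>0(Z) b(Z)]\<close>, and likewise \<open>E[a(X) b(Z)'] = P E[b(Z) b(Z)']\<close>,
  so \<open>P\<close> cancels in \<open>\<delta>\<close>, which is the coefficient of the least squares projection of \<open>\<gamma>0(Z)\<close>
  on \<open>b(Z)\<close>.\<close>

text \<open>A vector is the finite sum of its components placed along the axes. Components may lie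
  in any Euclidean space, so applying this twice covers matrices.\<close>

lemma integrable_vec_componentwise:
  fixes f :: "'w \<Rightarrow> 'b::euclidean_space ^ 'n::finite"
  assumes "\<And>i. integrable M (\<lambda>w. f w $ i)"
  shows "integrable M f"
proof -
  have lin: "bounded_linear (axis i :: 'b \<Rightarrow> 'b ^ 'n)" for i
    by (intro linear_conv_bounded_linear[THEN iffD1] linearI) (auto simp: vec_eq_iff axis_def)
  have "integrable M (\<lambda>w. \<Sum>i\<in>UNIV. axis i (f w $ i))"
    by (intro Bochner_Integration.integrable_sum integrable_bounded_linear[OF lin] assms)
  also have "(\<lambda>w. \<Sum>i\<in>UNIV. axis i (f w $ i)) = f"
    by (auto simp: vec_eq_iff axis_def fun_eq_iff)
  finally show ?thesis .
qed

lemma integral_vec_nth: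
  fixes f :: "'w \<Rightarrow> 'b::euclidean_space ^ 'n::finite"
  assumes "integrable M f"
  shows "(\<integral>w. f w \<partial>M) $ i = (\<integral>w. f w $ i \<partial>M)"
  by (rule integral_bounded_linear[OF bounded_linear_vec_nth assms, symmetric])

lemma integral_matrix_vector_mult:
  fixes A :: "real ^ 'n::finite ^ 'm::finite"
  assumes "integrable M f"
  shows "(\<integral>w. A *v f w \<partial>M) = A *v (\<integral>w. f w \<partial>M)"
  by (rule integral_bounded_linear[OF matrix_vector_mul_bounded_linear assms])

text \<open>Dominated via 2|fg| \<le> f^2 + g^2. This is where finite second moments make every
  cross moment in the proof exist.\<close>

lemma integrable_mult_square_integrable:
  fixes f g :: "'w \<Rightarrow> real"
  assumes "f \<in> borel_measurable M" "g \<in> borel_measurable M"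
    and "integrable M (\<lambda>w. (f w)\<^sup>2)" "integrable M (\<lambda>w. (g w)\<^sup>2)"
  shows "integrable M (\<lambda>w. f w * g w)"
proof (rule Bochner_Integration.integrable_bound)
  show "integrable M (\<lambda>w. (f w)\<^sup>2 + (g w)\<^sup>2)"
    using assms by simp
  have "norm (f w * g w) \<le> norm ((f w)\<^sup>2 + (g w)\<^sup>2)" for w
  proof -
    have "2 * (\<bar>f w\<bar> * \<bar>g w\<bar>) \<le> (f w)\<^sup>2 + (g w)\<^sup>2"
      using sum_squares_bound[of "\<bar>f w\<bar>" "\<bar>g w\<bar>"] by (simp add: mult.assoc)
    moreover have "0 \<le> \<bar>f w\<bar> * \<bar>g w\<bar>" by simp
    ultimately have "\<bar>f w\<bar> * \<bar>g w\<bar> \<le> (f w)\<^sup>2 + (g w)\<^sup>2" by linarith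
    then show ?thesis by (simp add: abs_mult)
  qed
  then show "AE w in M. norm (f w * g w) \<le> norm ((f w)\<^sup>2 + (g w)\<^sup>2)"
    by simp
qed (use assms in measurable)

lemma borel_measurable_vec_nth [measurable (raw)]:
  fixes f :: "'w \<Rightarrow> real ^ 'n::finite"
  assumes "f \<in> borel_measurable M"
  shows "(\<lambda>w. f w $ i) \<in> borel_measurable M"
  using measurable_compose[OF assms borel_measurable_nth] .

text \<open>\<open>matrix_inv\<close> is a Hilbert choice, which satisfies its defining equations
  once some inverse exists.\<close>

lemma invertible_matrix_inv_right:
  assumes "invertible A"
  shows "A ** matrix_inv A = mat 1"
  using someI_ex[OF assms[unfolded invertible_def]] unfolding matrix_inv_def by blast

lemma integrable_square_vec_nth:
  fixes f :: "'w \<Rightarrow> real ^ 'n::finite"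
  assumes [measurable]: "f \<in> borel_measurable M" and "integrable M (\<lambda>w. (norm (f w))\<^sup>2)"
  shows "integrable M (\<lambda>w. (f w $ i)\<^sup>2)"
proof (rule Bochner_Integration.integrable_bound[OF assms(2)])
  show "AE w in M. norm ((f w $ i)\<^sup>2) \<le> norm ((norm (f w))\<^sup>2)"
    using power_mono[OF component_le_norm_cart abs_ge_zero, of "f _" i 2] by simp
qed simp

text \<open>Applied to a fixed vector, a matrix moment becomes the moment of a vector with a scalar
  weight, the form that the conditioning arguments handle.\<close>

lemma outer_product_mult_vec: "outer_product u v *v x = (v \<bullet> x) *\<^sub>R u"
  by (simp add: outer_product_def matrix_vector_mult_def vec_eq_iff inner_vec_def
      sum_distrib_left mult_ac)

lemma integrable_outer_product:
  fixes u :: "'w \<Rightarrow> real ^ 'm::finite" and v :: "'w \<Rightarrow> real ^ 'n::finite"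
  assumes [measurable]: "u \<in> borel_measurable M" "v \<in> borel_measurable M"
    and "integrable M (\<lambda>w. (norm (u w))\<^sup>2)" "integrable M (\<lambda>w. (norm (v w))\<^sup>2)"
  shows "integrable M (\<lambda>w. outer_product (u w) (v w))"
  unfolding outer_product_def
  by (intro integrable_vec_componentwise)
    (use assms in \<open>auto intro!: integrable_mult_square_integrable integrable_square_vec_nth\<close>)

lemma integrable_scaleR_square_integrable:
  fixes f :: "'w \<Rightarrow> real" and v :: "'w \<Rightarrow> real ^ 'n::finite"
  assumes [measurable]: "f \<in> borel_measurable M" "v \<in> borel_measurable M"
    and "integrable M (\<lambda>w. (f w)\<^sup>2)" "integrable M (\<lambda>w. (norm (v w))\<^sup>2)"
  shows "integrable M (\<lambda>w. f w *\<^sub>R v w)"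
  by (intro integrable_vec_componentwise)
    (use assms in \<open>auto intro!: integrable_mult_square_integrable integrable_square_vec_nth\<close>)

lemma subalgebra_sigma_gen:
  assumes "V \<in> measurable M N"
  shows "subalgebra M (sigma_gen M N V)"
  unfolding subalgebra_def sigma_gen_def using assms
  by (auto simp: sets_vimage_algebra2 measurable_space intro: measurable_sets)

text \<open>The weight is measurable for the sigma-algebra generated by \<open>V\<close>, so this is
  the characterizing property of conditional expectation.\<close>

lemma (in prob_space) integral_mult_cond_exp_sigma_gen:
  fixes g :: "'a \<Rightarrow> real"
  assumes [measurable]: "V \<in> measurable M N" "h \<in> borel_measurable N" "g \<in> borel_measurable M"
    and "integrable M (\<lambda>w. h (V w) * g w)"
  shows "(\<integral>w. h (V w) * real_cond_exp M (sigma_gen M N V) g w \<partial>M) = (\<integral>w. h (V w) * g w \<partial>M)"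
proof -
  interpret finite_measure_subalgebra M "sigma_gen M N V"
    by unfold_locales (rule subalgebra_sigma_gen[OF assms(1)])
  have "V \<in> measurable (sigma_gen M N V) N"
    unfolding sigma_gen_def by (rule measurable_vimage_algebra1) (use measurable_space[OF assms(1)] in auto)
  from measurable_compose[OF this assms(2)] show ?thesis
    by (intro real_cond_exp_intg(2)) (use assms in auto)
qed

text \<open>The scalar identity in each component, with the conditional expectation then exchanged
  for its given version \<open>r\<close>. Integrability of the weighted \<open>r\<close> also
  supplies the measurability that the exchange requires.\<close>

lemma (in prob_space) integral_scaleR_vec_cond_exp:
  fixes u :: "'a \<Rightarrow> real ^ 'd::finite"
  assumes V: "V \<in> measurable M N" and h: "h \<in> borel_measurable N"
    and u: "u \<in> borel_measurable M"
    and int: "integrable M (\<lambda>w. h (V w) *\<^sub>R u w)"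
    and r: "integrable M (\<lambda>w. h (V w) *\<^sub>R r w)"
    and ae: "AE w in M. vec_cond_exp M (sigma_gen M N V) u w = r w"
  shows "(\<integral>w. h (V w) *\<^sub>R u w \<partial>M) = (\<integral>w. h (V w) *\<^sub>R r w \<partial>M)"
proof (unfold vec_eq_iff, intro allI)
  fix i
  have ui: "(\<lambda>w. u w $ i) \<in> borel_measurable M" using u by measurable
  have inti: "integrable M (\<lambda>w. h (V w) * u w $ i)"
    using integrable_bounded_linear[OF bounded_linear_vec_nth int, of i] by simp
  have ri: "integrable M (\<lambda>w. h (V w) * r w $ i)"
    using integrable_bounded_linear[OF bounded_linear_vec_nth r, of i] by simp
  have "(\<integral>w. h (V w) * u w $ i \<partial>M)
      = (\<integral>w. h (V w) * real_cond_exp M (sigma_gen M N V) (\<lambda>w. u w $ i) w \<partial>M)"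
    by (rule integral_mult_cond_exp_sigma_gen[OF V h ui inti, symmetric])
  also have "\<dots> = (\<integral>w. h (V w) * r w $ i \<partial>M)"
  proof (rule integral_cong_AE)
    have "real_cond_exp M (sigma_gen M N V) (\<lambda>w. u w $ i) \<in> borel_measurable M"
      by (rule measurable_from_subalg[OF subalgebra_sigma_gen[OF V]]) simp
    then show "(\<lambda>w. h (V w) * real_cond_exp M (sigma_gen M N V) (\<lambda>w. u w $ i) w) \<in> borel_measurable M"
      using measurable_compose[OF V h] by simp
    show "AE w in M. h (V w) * real_cond_exp M (sigma_gen M N V) (\<lambda>w. u w $ i) w = h (V w) * r w $ i"
      using ae by eventually_elim (auto simp: vec_cond_exp_def vec_eq_iff)
  qed (use ri in simp)
  finally show "(\<integral>w. h (V w) *\<^sub>R u w \<partial>M) $ i = (\<integral>w. h (V w) *\<^sub>R r w \<partial>M) $ i"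
    by (simp add: integral_vec_nth[OF int] integral_vec_nth[OF r])
qed

theorem theorem14:
  fixes M :: "'w measure" and N :: "'x measure"
    and Y :: "'w \<Rightarrow> real" and Z :: "'w \<Rightarrow> real ^ 'n::finite" and X :: "'w \<Rightarrow> 'x"
    and f0 \<gamma>0 \<gamma>bar :: "real ^ 'n \<Rightarrow> real"
    and a :: "'x \<Rightarrow> real ^ 'd::finite" and b :: "real ^ 'n \<Rightarrow> real ^ 'd"
    and k :: 'n and \<theta>0 :: real and \<delta> c :: "real ^ 'd" and P :: "real ^ 'd ^ 'd"
  assumes "prob_space M"
    and "Y \<in> borel_measurable M" and "X \<in> measurable M N"
    and "\<And>z. f0 z \<ge> 0" and "distributed M lborel Z (\<lambda>z. ennreal (f0 z))"
    and "\<gamma>0 \<in> borel_measurable borel" and "a \<in> borel_measurable N" and "b \<in> borel_measurable borel"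
    and "integrable M (\<lambda>w. (Y w)\<^sup>2)"
    and "integrable M (\<lambda>w. (\<gamma>0 (Z w))\<^sup>2)"
    and "integrable M (\<lambda>w. (norm (a (X w)))\<^sup>2)"
    and "integrable M (\<lambda>w. (norm (b (Z w)))\<^sup>2)"
    and "AE w in M. real_cond_exp M (sigma_gen M N X) (\<lambda>w. Y w - \<gamma>0 (Z w)) w = 0"
    and "\<theta>0 = average_derivative M Z k \<gamma>0"
    and "\<delta> = iv_coef M Y Z X a b"
    and "\<gamma>bar = (\<lambda>z. b z \<bullet> \<delta>)"
    and "AE w in M. partial_differentiable k \<gamma>0 (Z w)"
    and "AE w in M. \<forall>i. partial_differentiable k (\<lambda>z. b z $ i) (Z w)"
    and "AE w in M. partial_differentiable k f0 (Z w)"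
    and "integration_by_parts M Z f0 k \<gamma>0"
    and "integration_by_parts M Z f0 k \<gamma>bar"
    and "AE w in M. - score k f0 (Z w) = c \<bullet> b (Z w)"
    and "invertible (\<integral>w. outer_product (b (Z w)) (b (Z w)) \<partial>M)"
    and "AE w in M. vec_cond_exp M (sigma_gen M borel Z) (\<lambda>w. a (X w)) w = P *v b (Z w)"
    and "invertible P"
  shows "\<theta>0 = average_derivative M Z k \<gamma>bar"
proof -
  interpret prob_space M by fact
  note [measurable] = assms(2,3,6,7,8)
  have Z[measurable]: "Z \<in> borel_measurable M"
    using assms(5) by (simp add: distributed_def)
  \<comment> \<open>The target is the system of normal equations \<open>B *v \<delta> = m\<close>
    for projecting \<gamma>0(Z) on b(Z).\<close>
  define B where "B = (\<integral>w. outer_product (b (Z w)) (b (Z w)) \<partial>M)"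
  define m where "m = (\<integral>w. \<gamma>0 (Z w) *\<^sub>R b (Z w) \<partial>M)"
  have aX: "(\<lambda>w. a (X w)) \<in> borel_measurable M"
    by simp
  note sq = assms(9-12)
  have int_bb: "integrable M (\<lambda>w. outer_product (b (Z w)) (b (Z w)))"
    and int_ab: "integrable M (\<lambda>w. outer_product (a (X w)) (b (Z w)))"
    using sq by (auto intro!: integrable_outer_product)
  have int_gb: "integrable M (\<lambda>w. \<gamma>0 (Z w) *\<^sub>R b (Z w))"
    and int_ga: "integrable M (\<lambda>w. \<gamma>0 (Z w) *\<^sub>R a (X w))"
    and int_Ya: "integrable M (\<lambda>w. Y w *\<^sub>R a (X w))"
    using sq by (auto intro!: integrable_scaleR_square_integrable)
  \<comment> \<open>Evaluation at a fixed vector is linear in the matrix, so it commutes with the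
    integral.\<close>
  have mat: "bounded_linear (\<lambda>A :: real ^ 'd ^ 'd. A *v x)" for x
    by (intro linear_conv_bounded_linear[THEN iffD1] linearI)
      (auto simp: matrix_vector_mult_add_rdistrib scaleR_matrix_vector_assoc)
  \<comment> \<open>Conditioning on \<open>Z\<close> replaces a(X) by P b(Z) under any weight h(Z).
    It is applied below with the weights \<gamma>0 and b \<bullet> x.\<close>
  have cond_Z: "(\<integral>w. h (Z w) *\<^sub>R a (X w) \<partial>M) = P *v (\<integral>w. h (Z w) *\<^sub>R b (Z w) \<partial>M)"
    if h: "h \<in> borel_measurable borel" and ha: "integrable M (\<lambda>w. h (Z w) *\<^sub>R a (X w))"
      and hb: "integrable M (\<lambda>w. h (Z w) *\<^sub>R b (Z w))" for h
  proof -
    have "integrable M (\<lambda>w. P *v (h (Z w) *\<^sub>R b (Z w)))"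
      by (rule integrable_bounded_linear[OF matrix_vector_mul_bounded_linear hb])
    then have "integrable M (\<lambda>w. h (Z w) *\<^sub>R (P *v b (Z w)))"
      by (simp add: matrix_vector_mult_scaleR)
    from integral_scaleR_vec_cond_exp[OF Z h aX ha this assms(24)]
    show ?thesis
      using integral_matrix_vector_mult[OF hb, of P] by (simp add: matrix_vector_mult_scaleR)
  qed
  have ga: "(\<integral>w. \<gamma>0 (Z w) *\<^sub>R a (X w) \<partial>M) = P *v m"
    unfolding m_def by (rule cond_Z[OF assms(6) int_ga int_gb])
  have Ya: "(\<integral>w. Y w *\<^sub>R a (X w) \<partial>M) = P *v m"
  proof -
    have int: "integrable M (\<lambda>w. (Y w - \<gamma>0 (Z w)) *\<^sub>R a (X w))"
      using Bochner_Integration.integrable_diff[OF int_Ya int_ga]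
      by (simp add: scaleR_diff_left)
    \<comment> \<open>Here the roles are reversed: each component of a(X) is the weight, and the
      structural residual is what gets conditioned, with conditional mean zero given
      \<open>X\<close>.\<close>
    have "(\<integral>w. (Y w - \<gamma>0 (Z w)) *\<^sub>R a (X w) \<partial>M) = 0"
    proof (unfold vec_eq_iff, intro allI)
      fix i
      have ai: "(\<lambda>x. a x $ i) \<in> borel_measurable N" by simp
      have inti: "integrable M (\<lambda>w. a (X w) $ i * (Y w - \<gamma>0 (Z w)))"
        using integrable_bounded_linear[OF bounded_linear_vec_nth int, of i]
        by (simp add: mult.commute)
      have "(\<integral>w. a (X w) $ i * (Y w - \<gamma>0 (Z w)) \<partial>M)
         = (\<integral>w. a (X w) $ i * real_cond_exp M (sigma_gen M N X) (\<lambda>w. Y w - \<gamma>0 (Z w)) w \<partial>M)"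
        by (rule integral_mult_cond_exp_sigma_gen[OF assms(3) ai _ inti, symmetric]) simp
      also have "\<dots> = 0"
        by (rule integral_eq_zero_AE) (use assms(13) in auto)
      finally show "(\<integral>w. (Y w - \<gamma>0 (Z w)) *\<^sub>R a (X w) \<partial>M) $ i = 0 $ i"
        by (simp add: integral_vec_nth[OF int] mult.commute)
    qed
    then show ?thesis
      using ga int_Ya int_ga by (simp add: scaleR_diff_left)
  qed
  \<comment> \<open>Tested on an arbitrary vector x, the matrix identity is \<open>cond_Z\<close>
    with weight b(Z) \<bullet> x.\<close>
  have ab: "(\<integral>w. outer_product (a (X w)) (b (Z w)) \<partial>M) = P ** B"
  proof (rule matrix_eq[THEN iffD2], intro allI)
    fix x :: "real ^ 'd"
    have xb: "(\<lambda>z. b z \<bullet> x) \<in> borel_measurable borel" by simp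
    have ax: "integrable M (\<lambda>w. (b (Z w) \<bullet> x) *\<^sub>R a (X w))"
      using integrable_bounded_linear[OF mat int_ab] by (simp add: outer_product_mult_vec)
    have bx: "integrable M (\<lambda>w. (b (Z w) \<bullet> x) *\<^sub>R b (Z w))"
      using integrable_bounded_linear[OF mat int_bb] by (simp add: outer_product_mult_vec)
    show "(\<integral>w. outer_product (a (X w)) (b (Z w)) \<partial>M) *v x = (P ** B) *v x"
      using cond_Z[OF xb ax bx] integral_bounded_linear[OF mat int_ab, of x]
        integral_bounded_linear[OF mat int_bb, of x]
      by (simp add: outer_product_mult_vec B_def flip: matrix_vector_mul_assoc)
  qed
  have PB: "invertible (P ** B)"
    using assms(23,25) by (simp add: B_def invertible_mult)
  have "\<delta> = matrix_inv (P ** B) *v (P *v m)"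
    by (simp add: assms(15) iv_coef_def ab Ya)
  \<comment> \<open>Multiplying by \<open>P ** B\<close> removes the inverse in \<delta> without
    expanding it; cancelling \<open>P\<close> then leaves the normal equations.\<close>
  then have "P *v (B *v \<delta>) = (P ** B ** matrix_inv (P ** B)) *v (P *v m)"
    by (simp only: matrix_vector_mul_assoc matrix_mul_assoc)
  then have "P *v (B *v \<delta>) = P *v m"
    by (simp add: invertible_matrix_inv_right[OF PB])
  then have B\<delta>: "B *v \<delta> = m"
    using assms(25) by (metis invertible_left_inverse matrix_vector_mul_assoc matrix_vector_mul_lid)
  \<comment> \<open>The minus sign of integration by parts is absorbed by the hypothesis that the
    negative score is c \<bullet> b(Z). The average derivative thus depends on g only through
    E[g(Z) b(Z)].\<close>
  have AD: "average_derivative M Z k g = c \<bullet> (\<integral>w. g (Z w) *\<^sub>R b (Z w) \<partial>M)"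
    if parts: "integration_by_parts M Z f0 k g"
      and g: "integrable M (\<lambda>w. g (Z w) *\<^sub>R b (Z w))" for g
  proof -
    \<comment> \<open>The score is a pointwise derivative, so the measurability of its product with
      g is taken from this integrability clause.\<close>
    have si: "integrable M (\<lambda>w. score k f0 (Z w) * g (Z w))"
      using parts by (simp add: integration_by_parts_def)
    have "average_derivative M Z k g = (\<integral>w. - (score k f0 (Z w) * g (Z w)) \<partial>M)"
      using parts by (simp add: integration_by_parts_def average_derivative_def)
    also have "\<dots> = (\<integral>w. c \<bullet> (g (Z w) *\<^sub>R b (Z w)) \<partial>M)"
    proof (rule integral_cong_AE)
      show "AE w in M. - (score k f0 (Z w) * g (Z w)) = c \<bullet> (g (Z w) *\<^sub>R b (Z w))"
        using assms(22) by eventually_elim (metis inner_scaleR_right mult.commute mult_minus_left)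
      show "(\<lambda>w. c \<bullet> (g (Z w) *\<^sub>R b (Z w))) \<in> borel_measurable M"
        by (rule borel_measurable_integrable[OF integrable_inner_right]) (rule g)
    qed (use si in simp)
    also have "\<dots> = c \<bullet> (\<integral>w. g (Z w) *\<^sub>R b (Z w) \<partial>M)"
      by (rule integral_inner_right) (rule g)
    finally show ?thesis .
  qed
  \<comment> \<open>For \<gamma>bar the moment E[g(Z) b(Z)] is \<open>B *v \<delta>\<close>, which
    equals the moment \<open>m\<close> of \<gamma>0 by the normal equations.\<close>
  have "integrable M (\<lambda>w. (b (Z w) \<bullet> \<delta>) *\<^sub>R b (Z w))"
    using integrable_bounded_linear[OF mat int_bb] by (simp add: outer_product_mult_vec)
  moreover have "(\<integral>w. (b (Z w) \<bullet> \<delta>) *\<^sub>R b (Z w) \<partial>M) = B *v \<delta>"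
    using integral_bounded_linear[OF mat int_bb, of \<delta>] by (simp add: outer_product_mult_vec B_def)
  ultimately have "average_derivative M Z k \<gamma>bar = c \<bullet> m"
    using AD[OF assms(21)] by (simp add: assms(16) B\<delta>)
  with AD[OF assms(20) int_gb] show ?thesis
    by (simp add: assms(14) m_def)
qed

end
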